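(* Let $G\subseteq\mathrm{GL}(n)$ be a symmetric subgroup with $K=G\cap U(n)$, and let $\pi\colon G\to\mathrm{GL}(V)$ be a rational representation on a finite-dimensional complex vector space with a $K$-invariant Hermitian inner product. For every $v\in V\setminus\{0\}$, the function $F_v\colon G\to\mathbb R$, $F_v(g)=\log\|\pi(g)v\|$, is $4N(\pi)$-robust; that is, $$\bigl|\partial_t^3F_v(e^{tH}g)\bigr|\le4N(\pi)\,\|H\|_F\;\partial_t^2F_v(e^{tH}g)$$ for all $g\in G$, $H\in i\mathrm{Lie}(K)$ and $t\in\mathbb R$.
   Context: Symmetric subgroup: a connected, Zariski-closed subgroup $G\subseteq\mathrm{GL}(n)$ (over $\mathbb C$) with $g^\dagger\in G$ for all $g\in G$. $\mathrm{Lie}(K)=\{X:e^{tX}\in K\ \forall t\in\mathbb R\}$, so $i\mathrm{Lie}(K)\subseteq\mathrm{Herm}(n)$. Rational representation: a homomorphism whose matrix entries are polynomials in the $g_{i,j}$ and $\det(g)^{-1}$; $\pi(K)$ acts by unitary maps. $\Pi(H)=\partial_{t=0}\pi(e^{tH})$. Weight norm: $N(\pi)=\max\{\|\Pi(H)\|_{\mathrm{op}}:H\in i\mathrm{Lie}(K),\|H\|_F=1\}$. *)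

theory Defs
  imports "HOL-Analysis.Analysis" "HOL-Algebra.Group"
begin

subsection \<open>Matrix groups\<close>

definition GL_mat :: "(complex^'n^'n) monoid" where
  "GL_mat = \<lparr>carrier = {g. invertible g}, mult = (**), one = mat 1\<rparr>"

definition dagger :: "complex^'n^'n \<Rightarrow> complex^'n^'n" where
  "dagger A = map_matrix cnj (transpose A)"

definition unitary_group :: "(complex^'n^'n) set" where
  "unitary_group = {g. dagger g ** g = mat 1 \<and> g ** dagger g = mat 1}"

text \<open>The algebra of functions generated by \<^term>\<open>F\<close> and the constants.\<close>

inductive_set polynomials_in :: "('a \<Rightarrow> complex) set \<Rightarrow> ('a \<Rightarrow> complex) set"
  for F :: "('a \<Rightarrow> complex) set" where
  const: "(\<lambda>x. c) \<in> polynomials_in F"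
| gen: "f \<in> F \<Longrightarrow> f \<in> polynomials_in F"
| add: "p \<in> polynomials_in F \<Longrightarrow> q \<in> polynomials_in F \<Longrightarrow> (\<lambda>x. p x + q x) \<in> polynomials_in F"
| mult: "p \<in> polynomials_in F \<Longrightarrow> q \<in> polynomials_in F \<Longrightarrow> (\<lambda>x. p x * q x) \<in> polynomials_in F"

definition entry_functions :: "(complex^'n^'n \<Rightarrow> complex) set" where
  "entry_functions = {\<lambda>g. g $ i $ j | i j. True}"

definition zariski_GL :: "(complex^'n^'n) topology" where
  "zariski_GL = topology (\<lambda>U. \<exists>P \<subseteq> polynomials_in entry_functions.
     U = {g \<in> carrier GL_mat. \<exists>p\<in>P. p g \<noteq> 0})"

lemma istopology_zariski_GL:
  "istopology (\<lambda>U. \<exists>P \<subseteq> polynomials_in entry_functions.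
     U = {g :: complex^'n^'n. g \<in> carrier GL_mat \<and> (\<exists>p\<in>P. p g \<noteq> 0)})"
  (is "istopology ?L")
  unfolding istopology_def
proof (intro conjI allI impI)
  fix S T assume "?L S" "?L T"
  then obtain P Q where P: "P \<subseteq> polynomials_in entry_functions"
      "S = {g \<in> carrier GL_mat. \<exists>p\<in>P. p g \<noteq> 0}"
    and Q: "Q \<subseteq> polynomials_in entry_functions"
      "T = {g \<in> carrier GL_mat. \<exists>q\<in>Q. q g \<noteq> 0}"
    by blast
  let ?R = "{\<lambda>g. p g * q g | p q. p \<in> P \<and> q \<in> Q}"
  have "?R \<subseteq> polynomials_in entry_functions"
    using P(1) Q(1) by (auto intro: polynomials_in.mult)
  moreover have "S \<inter> T = {g \<in> carrier GL_mat. \<exists>p\<in>?R. p g \<noteq> 0}"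
    unfolding P(2) Q(2)
  proof (intro equalityI subsetI)
    fix g assume "g \<in> {g \<in> carrier GL_mat. \<exists>p\<in>P. p g \<noteq> 0} \<inter> {g \<in> carrier GL_mat. \<exists>q\<in>Q. q g \<noteq> 0}"
    then obtain p q where "g \<in> carrier GL_mat" "p \<in> P" "p g \<noteq> 0" "q \<in> Q" "q g \<noteq> 0"
      by blast
    moreover from this have "(\<lambda>g. p g * q g) \<in> ?R" by blast
    ultimately show "g \<in> {g \<in> carrier GL_mat. \<exists>p\<in>?R. p g \<noteq> 0}"
      by (intro CollectI conjI bexI[of _ "\<lambda>g. p g * q g"]) auto
  qed auto
  ultimately show "?L (S \<inter> T)" by blast
next
  fix \<K> assume "\<forall>K\<in>\<K>. ?L K"
  then obtain f where f: "\<forall>K\<in>\<K>. f K \<subseteq> polynomials_in entry_functions \<and>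
      K = {g \<in> carrier GL_mat. \<exists>p\<in>f K. p g \<noteq> 0}"
    unfolding bchoice_iff by (elim exE)
  have "\<Union>\<K> = (\<Union>K\<in>\<K>. {g \<in> carrier GL_mat. \<exists>p\<in>f K. p g \<noteq> 0})"
    using f by simp
  also have "\<dots> = {g \<in> carrier GL_mat. \<exists>p\<in>\<Union>(f ` \<K>). p g \<noteq> 0}"
    by auto
  finally have "\<Union>\<K> = {g \<in> carrier GL_mat. \<exists>p\<in>\<Union>(f ` \<K>). p g \<noteq> 0}" .
  moreover have "\<Union>(f ` \<K>) \<subseteq> polynomials_in entry_functions"
    using f by blast
  ultimately show "?L (\<Union>\<K>)" by (intro exI conjI)
qed

lemma openin_zariski_GL:
  "openin zariski_GL U \<longleftrightarrow> (\<exists>P \<subseteq> polynomials_in entry_functions.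
     U = {g \<in> carrier GL_mat. \<exists>p\<in>P. p g \<noteq> 0})"
  unfolding zariski_GL_def by (subst topology_inverse'[OF istopology_zariski_GL]) rule

lemma topspace_zariski_GL: "topspace zariski_GL = carrier GL_mat"
proof
  show "topspace zariski_GL \<subseteq> (carrier GL_mat :: (complex^'a^'a) set)"
    unfolding topspace_def openin_zariski_GL by blast
  have "openin zariski_GL (carrier GL_mat :: (complex^'a^'a) set)"
    unfolding openin_zariski_GL
    by (rule exI[of _ "{\<lambda>g. 1}"]) (auto intro: polynomials_in.const)
  then show "(carrier GL_mat :: (complex^'a^'a) set) \<subseteq> topspace zariski_GL"
    by (rule openin_subset)
qed

lemma closedin_zariski_GL:
  "closedin zariski_GL S \<longleftrightarrow> (\<exists>P \<subseteq> polynomials_in entry_functions.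
     S = {g \<in> carrier GL_mat. \<forall>p\<in>P. p g = 0})"
proof -
  have "S \<subseteq> carrier GL_mat \<and> carrier GL_mat - S = {g \<in> carrier GL_mat. \<exists>p\<in>P. p g \<noteq> 0}
      \<longleftrightarrow> S = {g \<in> carrier GL_mat. \<forall>p\<in>P. p g = 0}" for P
    by blast
  note eq = this[symmetric]
  show ?thesis
    unfolding closedin_def topspace_zariski_GL openin_zariski_GL eq by blast
qed

definition symmetric_subgroup :: "(complex^'n^'n) set \<Rightarrow> bool" where
  "symmetric_subgroup G \<longleftrightarrow>
     subgroup G GL_mat \<and> closedin zariski_GL G \<and> connectedin zariski_GL G \<and>
     (\<forall>g\<in>G. dagger g \<in> G)"

text \<open>The componentwise multiplication that the library puts on \<^typ>\<open>complex^'n^'n\<close> is not the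
  matrix product, so the library's \<^const>\<open>exp\<close> does not apply and the series is written out.\<close>

definition matrix_exp :: "complex^'n^'n \<Rightarrow> complex^'n^'n" where
  "matrix_exp A = (\<Sum>k. (1 / fact k) *\<^sub>R ((**) A ^^ k) (mat 1))"

definition Lie :: "(complex^'n^'n) set \<Rightarrow> (complex^'n^'n) set" where
  "Lie K = {X. \<forall>t::real. matrix_exp (t *\<^sub>R X) \<in> K}"

text \<open>The set \<open>i Lie(K)\<close> for \<open>K = G \<inter> U(n)\<close>.\<close>

definition i_Lie_K :: "(complex^'n^'n) set \<Rightarrow> (complex^'n^'n) set" where
  "i_Lie_K G = map_matrix ((*) \<i>) ` Lie (G \<inter> unitary_group)"


subsection \<open>Representations on Hermitian spaces\<close>

text \<open>A nonzero finite-dimensional complex vector space with a Hermitian inner product (linear in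
  the second argument), presented on its underlying real Euclidean space: the real inner product
  is the real part of the Hermitian one. Hence \<^const>\<open>norm\<close> is the Hermitian norm
  and \<^const>\<open>onorm\<close> the operator norm.\<close>

locale hermitian_space = vector_space scaleC
  for scaleC :: "complex \<Rightarrow> 'v::euclidean_space \<Rightarrow> 'v" +
  fixes cinner :: "'v \<Rightarrow> 'v \<Rightarrow> complex"
  assumes scaleC_of_real: "scaleC (of_real r) x = r *\<^sub>R x"
    and cinner_commute: "cinner x y = cnj (cinner y x)"
    and cinner_add_right: "cinner x (y + z) = cinner x y + cinner x z"
    and cinner_scaleC_right: "cinner x (scaleC c y) = c * cinner x y"
    and Re_cinner: "Re (cinner x y) = x \<bullet> y"

lemma hermitian_space_vec:
  "hermitian_space (*s) (\<lambda>x y :: complex^'m. \<Sum>i\<in>UNIV. cnj (x $ i) * y $ i)"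
proof (unfold_locales)
  fix r :: real and c and x y z :: "complex^'m"
  show "of_real r *s x = r *\<^sub>R x"
    by (rule vec_eq_iff[THEN iffD2]) (simp add: complex_eq_iff)
  show "(\<Sum>i\<in>UNIV. cnj (x $ i) * y $ i) = cnj (\<Sum>i\<in>UNIV. cnj (y $ i) * x $ i)"
    by (simp add: mult.commute)
  show "(\<Sum>i\<in>UNIV. cnj (x $ i) * (y + z) $ i)
      = (\<Sum>i\<in>UNIV. cnj (x $ i) * y $ i) + (\<Sum>i\<in>UNIV. cnj (x $ i) * z $ i)"
    by (simp add: distrib_left sum.distrib)
  show "(\<Sum>i\<in>UNIV. cnj (x $ i) * (c *s y) $ i) = c * (\<Sum>i\<in>UNIV. cnj (x $ i) * y $ i)"
    by (simp add: sum_distrib_left mult_ac)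
  show "Re (\<Sum>i\<in>UNIV. cnj (x $ i) * y $ i) = x \<bullet> y"
    by (simp add: inner_vec_def inner_complex_def)
qed

definition GL_space :: "(complex \<Rightarrow> 'v::ab_group_add \<Rightarrow> 'v) \<Rightarrow> ('v \<Rightarrow> 'v) monoid" where
  "GL_space scaleC =
     \<lparr>carrier = {f. Vector_Spaces.linear scaleC scaleC f \<and> bij f}, mult = (\<circ>), one = id\<rparr>"

text \<open>The matrix entries of \<open>\<pi>(g)\<close> are taken with respect to some complex basis \<open>B\<close>; whether they
  are polynomials in the entries of \<open>g\<close> and \<open>det(g)\<^sup>-\<^sup>1\<close> does not depend on the choice of \<open>B\<close>.\<close>

definition rational_representation ::
  "(complex \<Rightarrow> 'v::ab_group_add \<Rightarrow> 'v) \<Rightarrow> (complex^'n^'n) set \<Rightarrow> (complex^'n^'n \<Rightarrow> 'v \<Rightarrow> 'v) \<Rightarrow> bool" where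
  "rational_representation scaleC G \<pi> \<longleftrightarrow>
     \<pi> \<in> hom (GL_mat\<lparr>carrier := G\<rparr>) (GL_space scaleC) \<and>
     (\<exists>B. finite_dimensional_vector_space scaleC B \<and>
        (\<forall>b\<in>B. \<forall>b'\<in>B. \<exists>p \<in> polynomials_in (insert (\<lambda>g. inverse (det g)) entry_functions).
           \<forall>g\<in>G. module.representation scaleC B (\<pi> g b) b' = p g))"

text \<open>The infinitesimal representation \<open>\<Pi>\<close>.\<close>

definition Lie_rep ::
  "(complex^'n^'n \<Rightarrow> 'v::real_normed_vector \<Rightarrow> 'v) \<Rightarrow> complex^'n^'n \<Rightarrow> 'v \<Rightarrow> 'v" where
  "Lie_rep \<pi> H x = vector_derivative (\<lambda>t. \<pi> (matrix_exp (t *\<^sub>R H)) x) (at 0)"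

text \<open>The norm of \<^typ>\<open>complex^'n^'n\<close> is the Frobenius norm. The supremum is attained, by compactness,
  unless \<open>Lie(K) = 0\<close>; in that case the set is empty and the value irrelevant.\<close>

definition weight_norm ::
  "(complex^'n^'n) set \<Rightarrow> (complex^'n^'n \<Rightarrow> 'v::real_normed_vector \<Rightarrow> 'v) \<Rightarrow> real" where
  "weight_norm G \<pi> = Sup {onorm (Lie_rep \<pi> H) | H. H \<in> i_Lie_K G \<and> norm H = 1}"

text \<open>As \<^const>\<open>deriv\<close> is total, existence of the three derivatives is stated explicitly.\<close>

definition robust :: "(complex^'n^'n) set \<Rightarrow> real \<Rightarrow> (complex^'n^'n \<Rightarrow> real) \<Rightarrow> bool" where
  "robust G \<gamma> F \<longleftrightarrow>
     (\<forall>g\<in>G. \<forall>H\<in>i_Lie_K G. \<forall>t::real.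
        let f = (\<lambda>s::real. F (matrix_exp (s *\<^sub>R H) ** g)) in
          (\<forall>k<3. (deriv ^^ k) f differentiable at t) \<and>
          \<bar>(deriv ^^ 3) f t\<bar> \<le> \<gamma> * norm H * (deriv ^^ 2) f t)"

end

theory Submission
  imports Defs "HOL-Complex_Analysis.Conformal_Mappings"
begin

text \<open>
  Write \<open>H = \<i> X\<close> with \<open>X \<in> Lie(K)\<close>. The entire curve \<open>z \<mapsto> exp (z X)\<close> lies in \<open>K\<close> for real \<open>z\<close>, and since
  \<open>G\<close> is Zariski closed, analytic continuation puts the whole curve into \<open>G\<close>
  (\<open>zariski_closed_contains_complex_one_parameter\<close>); in particular \<open>exp (t H) \<in> G\<close>. Because the matrix
  entries of \<open>\<pi>\<close> are polynomial in the entries of \<open>g\<close> and \<open>det(g)\<^sup>-\<^sup>1\<close>, the derivative of \<open>\<pi>\<close> at the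
  identity is complex linear, so \<open>\<Pi>(H) = \<i> \<Pi>(X)\<close>. Invariance of the inner product under \<open>K\<close> makes
  \<open>\<Pi>(X)\<close> skew-Hermitian, and therefore \<open>S = \<Pi>(H)\<close> is Hermitian (\<open>Lie_rep_selfadjoint\<close>), with
  \<open>\<parallel>S\<parallel> \<le> N(\<pi>) \<parallel>H\<parallel>\<close> (\<open>norm_Lie_rep_le\<close>).

  The curve \<open>u t = \<pi>(exp (t H) g) v\<close> never vanishes and satisfies \<open>u' = S u\<close> (\<open>orbit_flow\<close>). For such a
  curve the second and third derivatives of \<open>ln \<parallel>u\<parallel>\<close> are \<open>2 V\<close> and \<open>4 K\<close>, where \<open>V\<close> is the variance and
  \<open>K\<close> the third central moment of the spectral distribution of \<open>S\<close> in the state \<open>u t\<close>. A random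
  variable with values in \<open>[-c, c]\<close> differs from its mean by at most \<open>2 c\<close>, so
  \<open>\<bar>K\<bar> \<le> 2 c V\<close>, that is \<open>\<bar>f'''\<bar> \<le> 4 c f''\<close> (\<open>log_norm_flow_robust\<close>). With \<open>c = N(\<pi>) \<parallel>H\<parallel>\<close> this is the
  claim.
\<close>

section \<open>Complex one-parameter subgroups of a matrix group\<close>

text \<open>The library's power \<open>A ^ k\<close> on matrices is entrywise, so the powers that occur in
  \<^const>\<open>matrix_exp\<close> get a name of their own. Likewise matrices carry only a real scaling, while the
  argument needs \<open>exp (z A)\<close> for complex \<open>z\<close>.\<close>

abbreviation mpower :: "complex^'n^'n \<Rightarrow> nat \<Rightarrow> complex^'n^'n" where
  "mpower A k \<equiv> ((**) A ^^ k) (mat 1)"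

abbreviation cscale :: "complex \<Rightarrow> complex^'n^'m \<Rightarrow> complex^'n^'m"  (infixr \<open>*\<^sub>M\<close> 75) where
  "z *\<^sub>M A \<equiv> map_matrix ((*) z) A"

lemma mpower_add: "mpower A (m + k) = mpower A m ** mpower A k"
  by (induction m) (simp_all add: matrix_mul_assoc)

lemma cscale_mult_left: "(z *\<^sub>M A) ** B = z *\<^sub>M (A ** B)"
  by (simp add: vec_eq_iff matrix_matrix_mult_def sum_distrib_left mult.assoc)

lemma cscale_mult_right: "A ** (z *\<^sub>M B) = z *\<^sub>M (A ** B)"
  by (simp add: vec_eq_iff matrix_matrix_mult_def sum_distrib_left mult_ac)

lemma cscale_cscale: "z *\<^sub>M w *\<^sub>M A = (z * w) *\<^sub>M A"
  by (simp add: vec_eq_iff mult.assoc)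

lemma cscale_one: "1 *\<^sub>M A = A"
  by (simp add: vec_eq_iff)

lemma scaleR_eq_cscale: "t *\<^sub>R A = of_real t *\<^sub>M A"
  by (simp add: vec_eq_iff scaleR_conv_of_real[where 'a = complex])

lemma mpower_cscale: "mpower (z *\<^sub>M A) k = z ^ k *\<^sub>M mpower A k"
proof (induction k)
  case 0
  show ?case by (simp add: vec_eq_iff)
next
  case (Suc k)
  then show ?case
    by (simp add: cscale_mult_left cscale_mult_right cscale_cscale)
qed

lemma summable_matrix_exp: "summable (\<lambda>k. norm ((1 / fact k) *\<^sub>R mpower A k))"
proof -
  have "linear ((**) A :: complex^'a^'a \<Rightarrow> complex^'a^'a)"
    by (rule linearI) (simp_all add: vec_eq_iff matrix_matrix_mult_def sum.distrib
        distrib_left scaleR_sum_right)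
  then have bl: "bounded_linear ((**) A :: complex^'a^'a \<Rightarrow> complex^'a^'a)"
    by (rule linear_conv_bounded_linear[THEN iffD1])
  define C where "C = onorm ((**) A :: complex^'a^'a \<Rightarrow> complex^'a^'a)"
  have "norm (mpower A k) \<le> norm (mat 1 :: complex^'a^'a) * C ^ k" for k
  proof (induction k)
    case (Suc k)
    have "norm (mpower A (Suc k)) \<le> C * norm (mpower A k)"
      using onorm[OF bl, of "mpower A k"] by (simp add: C_def)
    also have "\<dots> \<le> C * (norm (mat 1 :: complex^'a^'a) * C ^ k)"
      using Suc onorm_pos_le[OF bl] by (intro mult_left_mono) (auto simp: C_def)
    finally show ?case by (simp add: mult_ac)
  qed simp
  then have le: "norm (norm ((1 / fact k) *\<^sub>R mpower A k))
      \<le> norm (mat 1 :: complex^'a^'a) * (inverse (fact k) * C ^ k)" for k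
    by (simp add: field_simps)
  have "summable (\<lambda>k. norm (mat 1 :: complex^'a^'a) * (inverse (fact k) * C ^ k))"
    by (intro summable_mult summable_exp)
  then show ?thesis
    by (rule summable_comparison_test[rotated]) (use le in blast)
qed

text \<open>Every entry of \<open>exp (z A)\<close> is an entire power series in \<open>z\<close>; everything below about the matrix
  exponential is read off from these scalar series.\<close>

lemma matrix_exp_entry_sums:
  "(\<lambda>k. mpower A k $ i $ j / fact k * z ^ k) sums (matrix_exp (z *\<^sub>M A) $ i $ j)"
proof -
  have "(\<lambda>k. (1 / fact k) *\<^sub>R mpower (z *\<^sub>M A) k) sums matrix_exp (z *\<^sub>M A)"
    unfolding matrix_exp_def
    by (intro summable_sums summable_norm_cancel[OF summable_matrix_exp])
  from bounded_linear.sums[OF bounded_linear_vec_nth bounded_linear.sums[OF bounded_linear_vec_nth this]]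
  show ?thesis
    by (simp add: mpower_cscale scaleR_conv_of_real[where 'a = complex] field_simps)
qed

lemma summable_matrix_exp_entry:
  "summable (\<lambda>k. norm (mpower A k $ i $ j / fact k * z ^ k))"
proof (rule summable_comparison_test[OF _ summable_matrix_exp[of "z *\<^sub>M A"]], intro exI allI impI)
  fix k
  let ?B = "(1 / fact k) *\<^sub>R mpower (z *\<^sub>M A) k"
  have "norm (norm (mpower A k $ i $ j / fact k * z ^ k)) = norm (?B $ i $ j)"
    by (simp add: mpower_cscale norm_mult norm_divide norm_power)
  also have "\<dots> \<le> norm (?B $ i)"
    by (rule Finite_Cartesian_Product.norm_nth_le)
  also have "\<dots> \<le> norm ?B"
    by (rule Finite_Cartesian_Product.norm_nth_le)
  finally show "norm (norm (mpower A k $ i $ j / fact k * z ^ k)) \<le> norm ?B" .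
qed

lemma matrix_exp_entry: "matrix_exp (z *\<^sub>M A) $ i $ j = (\<Sum>k. mpower A k $ i $ j / fact k * z ^ k)"
  using matrix_exp_entry_sums by (rule sums_unique)

lemma matrix_exp_0: "matrix_exp (0 *\<^sub>M A) = mat 1"
  unfolding vec_eq_iff matrix_exp_entry powser_zero by simp

lemma matrix_exp_scaleR_0: "matrix_exp (0 *\<^sub>R A) = mat 1"
  using matrix_exp_0[of A] by (simp only: scaleR_eq_cscale of_real_0)

text \<open>Entrywise this is the Cauchy product of power series: the sum over the inner matrix index
  turns \<open>A ^ m\<close> and \<open>A ^ (k - m)\<close> into \<open>A ^ k\<close>, and what is left is the binomial theorem.\<close>

lemma matrix_exp_add:
  "matrix_exp ((z + w) *\<^sub>M A) = matrix_exp (z *\<^sub>M A) ** matrix_exp (w *\<^sub>M A)"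
proof -
  have "matrix_exp ((z + w) *\<^sub>M A) $ i $ j = (matrix_exp (z *\<^sub>M A) ** matrix_exp (w *\<^sub>M A)) $ i $ j" for i j
  proof -
    let ?a = "\<lambda>z i j k. mpower A k $ i $ j / fact k * z ^ k"
    have "(\<lambda>k. \<Sum>l\<in>UNIV. \<Sum>m\<le>k. ?a z i l m * ?a w l j (k - m))
        sums (\<Sum>l\<in>UNIV. matrix_exp (z *\<^sub>M A) $ i $ l * matrix_exp (w *\<^sub>M A) $ l $ j)"
      unfolding matrix_exp_entry
      by (intro sums_sum Cauchy_product_sums summable_matrix_exp_entry)
    moreover have "(\<Sum>l\<in>UNIV. \<Sum>m\<le>k. ?a z i l m * ?a w l j (k - m)) = ?a (z + w) i j k" for k
    proof -
      have "(\<Sum>l\<in>UNIV. \<Sum>m\<le>k. ?a z i l m * ?a w l j (k - m))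
          = (\<Sum>m\<le>k. \<Sum>l\<in>UNIV. ?a z i l m * ?a w l j (k - m))"
        by (rule sum.swap)
      also have "\<dots> = (\<Sum>m\<le>k. (mpower A m ** mpower A (k - m)) $ i $ j *
          (z ^ m * w ^ (k - m) / (fact m * fact (k - m))))"
        by (simp add: matrix_matrix_mult_def sum_distrib_left sum_divide_distrib mult_ac)
      also have "\<dots> = (\<Sum>m\<le>k. mpower A k $ i $ j / fact k * (of_nat (k choose m) * z ^ m * w ^ (k - m)))"
        by (intro sum.cong) (auto simp: mpower_add[symmetric] binomial_fact field_simps)
      also have "\<dots> = ?a (z + w) i j k"
        by (simp add: binomial_ring sum_distrib_left)
      finally show ?thesis .
    qed
    ultimately have "?a (z + w) i j sums (matrix_exp (z *\<^sub>M A) ** matrix_exp (w *\<^sub>M A)) $ i $ j"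
      by (simp add: matrix_matrix_mult_def)
    then show ?thesis
      by (rule sums_unique2[OF matrix_exp_entry_sums])
  qed
  then show ?thesis by (simp add: vec_eq_iff)
qed

lemma invertible_matrix_exp: "invertible (matrix_exp (z *\<^sub>M A))"
proof -
  have "matrix_exp (z *\<^sub>M A) ** matrix_exp ((- z) *\<^sub>M A) = mat 1"
    using matrix_exp_add[of z "- z" A] matrix_exp_0[of A] unfolding right_minus by metis
  moreover have "matrix_exp ((- z) *\<^sub>M A) ** matrix_exp (z *\<^sub>M A) = mat 1"
    using matrix_exp_add[of "- z" z A] matrix_exp_0[of A] unfolding left_minus by metis
  ultimately show ?thesis unfolding invertible_def by blast
qed

lemma matrix_exp_entry_has_field_derivative:
  "((\<lambda>z. matrix_exp (z *\<^sub>M A) $ i $ j) has_field_derivative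
     (\<Sum>k. diffs (\<lambda>k. mpower A k $ i $ j / fact k) k * z ^ k)) (at z)"
  unfolding matrix_exp_entry
  by (rule termdiffs_strong_converges_everywhere) (rule summable_norm_cancel[OF summable_matrix_exp_entry])

lemma matrix_exp_entry_has_field_derivative_0:
  "((\<lambda>z. matrix_exp (z *\<^sub>M A) $ i $ j) has_field_derivative A $ i $ j) (at 0)"
  using matrix_exp_entry_has_field_derivative[of A i j 0] by (simp add: powser_zero diffs_def)

lemma matrix_exp_has_vector_derivative_0:
  "((\<lambda>t::real. matrix_exp (t *\<^sub>R A)) has_vector_derivative A) (at 0)"
proof -
  have "((\<lambda>t::real. matrix_exp (of_real t *\<^sub>M A) $ i $ j) has_vector_derivative A $ i $ j) (at 0)" for i j
    using matrix_exp_entry_has_field_derivative_0[of A i j]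
    by (intro has_vector_derivative_real_field) simp
  then have "((\<lambda>t::real. matrix_exp (t *\<^sub>R A) $ i $ j \<bullet> b) has_derivative (\<lambda>t. (t *\<^sub>R A $ i $ j) \<bullet> b)) (at 0)" for i j b
    unfolding has_vector_derivative_def scaleR_eq_cscale by (rule has_derivative_inner_left)
  then show ?thesis
    unfolding has_vector_derivative_def has_derivative_componentwise_within[where 'b = "complex^'a^'a"]
    by (auto simp: Basis_vec_def inner_axis)
qed

lemma holomorphic_polynomial_matrix_exp:
  assumes "p \<in> polynomials_in entry_functions"
  shows "(\<lambda>z. p (matrix_exp (z *\<^sub>M A))) holomorphic_on UNIV"
  using assms
proof induction
  case (gen f)
  then obtain i j where "f = (\<lambda>g. g $ i $ j)"
    by (auto simp: entry_functions_def)
  then show ?case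
    using matrix_exp_entry_has_field_derivative[of A i j]
    by (auto simp: holomorphic_on_def field_differentiable_def)
qed (auto intro: holomorphic_intros)

text \<open>A polynomial that vanishes on \<open>G\<close> pulls back along \<open>z \<mapsto> exp (z A)\<close> to an entire function that
  vanishes on the real line, hence everywhere. This is how \<open>exp (t H)\<close> with \<open>H \<in> i Lie(K)\<close>, which is
  not unitary in general, comes to lie in \<open>G\<close>.\<close>

lemma zariski_closed_contains_complex_one_parameter:
  assumes "closedin zariski_GL G" and real: "\<And>t::real. matrix_exp (t *\<^sub>R A) \<in> G"
  shows "matrix_exp (z *\<^sub>M A) \<in> G"
proof -
  obtain P where P: "P \<subseteq> polynomials_in entry_functions"
    and G: "G = {g \<in> carrier GL_mat. \<forall>p\<in>P. p g = 0}"
    using assms(1) unfolding closedin_zariski_GL by blast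
  have "p (matrix_exp (z *\<^sub>M A)) = 0" if "p \<in> P" for p
  proof (rule analytic_continuation[where S = UNIV and U = "\<real>" and \<xi> = 0
        and f = "\<lambda>w. p (matrix_exp (w *\<^sub>M A))"])
    show "(\<lambda>z. p (matrix_exp (z *\<^sub>M A))) holomorphic_on UNIV"
      using P that by (intro holomorphic_polynomial_matrix_exp) auto
    show "p (matrix_exp (w *\<^sub>M A)) = 0" if "w \<in> \<real>" for w
      using that real \<open>p \<in> P\<close> by (auto simp: Reals_def scaleR_eq_cscale G)
    show "(0::complex) islimpt \<real>"
      unfolding islimpt_approachable
    proof (intro allI impI)
      fix e :: real assume "e > 0"
      then show "\<exists>x\<in>\<real>. x \<noteq> (0::complex) \<and> dist x 0 < e"
        by (intro bexI[of _ "of_real (e / 2)"]) (auto simp: norm_divide)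
    qed
  qed auto
  then show ?thesis
    by (simp add: G GL_mat_def invertible_matrix_exp)
qed

section \<open>Complex derivatives of polynomial functions of a matrix\<close>

text \<open>A complex derivative on a matrix space is expressed as a real Frechet derivative that commutes
  with complex scalars. Having one is inherited from the generators by sums and products.\<close>

lemma polynomials_in_has_complex_derivative:
  assumes "p \<in> polynomials_in F"
    and "\<And>f. f \<in> F \<Longrightarrow> \<exists>D. (f has_derivative D) (at g) \<and> (\<forall>c M. D (c *\<^sub>M M) = c * D M)"
  shows "\<exists>D. (p has_derivative D) (at g) \<and> (\<forall>c M. D (c *\<^sub>M M) = c * D M)"
  using assms(1)
proof induction
  case (const c)
  show ?case by (intro exI[of _ "\<lambda>_. 0"]) simp
next
  case (gen f)
  then show ?case by (rule assms(2))
next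
  case (add p q)
  then obtain D E where "(p has_derivative D) (at g)" "\<forall>c M. D (c *\<^sub>M M) = c * D M"
      "(q has_derivative E) (at g)" "\<forall>c M. E (c *\<^sub>M M) = c * E M"
    by blast
  then show ?case
    by (intro exI[of _ "\<lambda>M. D M + E M"]) (auto intro: has_derivative_add simp: distrib_left)
next
  case (mult p q)
  then obtain D E where "(p has_derivative D) (at g)" "\<forall>c M. D (c *\<^sub>M M) = c * D M"
      "(q has_derivative E) (at g)" "\<forall>c M. E (c *\<^sub>M M) = c * E M"
    by blast
  then show ?case
    by (intro exI[of _ "\<lambda>M. p g * E M + D M * q g"] conjI has_derivative_mult)
      (simp_all add: algebra_simps)
qed

lemma entry_function_has_complex_derivative:
  fixes f :: "complex^'n^'n \<Rightarrow> complex"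
  assumes "f \<in> entry_functions"
  shows "\<exists>D. (f has_derivative D) (at g) \<and> (\<forall>c M. D (c *\<^sub>M M) = c * D M)"
proof -
  obtain i j where f: "f = (\<lambda>g. g $ i $ j)"
    using assms by (auto simp: entry_functions_def)
  have "bounded_linear (\<lambda>g :: complex^'n^'n. g $ i $ j)"
    by (intro bounded_linear_compose[OF bounded_linear_vec_nth] bounded_linear_vec_nth)
  then show ?thesis
    unfolding f by (intro exI[of _ "\<lambda>g. g $ i $ j"]) (auto intro: bounded_linear_imp_has_derivative)
qed

lemma polynomials_in_sum:
  "finite I \<Longrightarrow> (\<And>i. i \<in> I \<Longrightarrow> p i \<in> polynomials_in F) \<Longrightarrow> (\<lambda>x. \<Sum>i\<in>I. p i x) \<in> polynomials_in F"
  by (induction rule: finite_induct) (auto intro: polynomials_in.intros)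

lemma polynomials_in_prod:
  "finite I \<Longrightarrow> (\<And>i. i \<in> I \<Longrightarrow> p i \<in> polynomials_in F) \<Longrightarrow> (\<lambda>x. \<Prod>i\<in>I. p i x) \<in> polynomials_in F"
  by (induction rule: finite_induct) (auto intro: polynomials_in.intros)

lemma det_polynomial: "det \<in> polynomials_in (entry_functions :: (complex^'n^'n \<Rightarrow> complex) set)"
proof -
  have "(\<lambda>A :: complex^'n^'n. \<Sum>p\<in>{p. p permutes UNIV}. of_int (sign p) * (\<Prod>i\<in>UNIV. A $ i $ p i))
      \<in> polynomials_in entry_functions"
    by (intro polynomials_in_sum polynomials_in.mult polynomials_in.const polynomials_in_prod polynomials_in.gen)
      (auto simp: entry_functions_def)
  then show ?thesis
    by (simp add: det_def[abs_def])
qed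

lemma inverse_det_has_complex_derivative:
  fixes g :: "complex^'n^'n"
  assumes "invertible g"
  shows "\<exists>D. ((\<lambda>g. inverse (det g)) has_derivative D) (at g) \<and> (\<forall>c M. D (c *\<^sub>M M) = c * D M)"
proof -
  obtain D where "(det has_derivative D) (at g)" and D: "\<forall>c M. D (c *\<^sub>M M) = c * D M"
    using polynomials_in_has_complex_derivative[OF det_polynomial entry_function_has_complex_derivative] by blast
  moreover have "det g \<noteq> 0"
    using assms by (simp add: invertible_det_nz)
  ultimately have "((\<lambda>g. inverse (det g)) has_derivative (\<lambda>M. - (inverse (det g) * D M * inverse (det g)))) (at g)"
    by (intro Deriv.has_derivative_inverse)
  then show ?thesis
    using D by (intro exI[of _ "\<lambda>M. - (inverse (det g) * D M * inverse (det g))"]) (simp add: mult_ac)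
qed

section \<open>The infinitesimal representation\<close>

text \<open>The standing hypotheses on \<open>G\<close> and \<open>\<pi>\<close>, collected so that the infinitesimal representation can
  be studied without repeating them.\<close>

locale unitary_rational_representation = hermitian_space scaleC cinner
  for scaleC :: "complex \<Rightarrow> 'v::euclidean_space \<Rightarrow> 'v" and cinner :: "'v \<Rightarrow> 'v \<Rightarrow> complex" +
  fixes G :: "(complex^'n^'n) set" and \<pi> :: "complex^'n^'n \<Rightarrow> 'v \<Rightarrow> 'v"
  assumes symmetric: "symmetric_subgroup G"
    and rational: "rational_representation scaleC G \<pi>"
    and unitary: "k \<in> G \<inter> unitary_group \<Longrightarrow> cinner (\<pi> k x) (\<pi> k y) = cinner x y"
begin

lemma bounded_linear_scaleC: "bounded_linear (scaleC c)"
proof -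
  have "scaleC c (r *\<^sub>R x) = r *\<^sub>R scaleC c x" for r x
    by (metis scale_left_commute scaleC_of_real)
  then show ?thesis
    by (intro linear_conv_bounded_linear[THEN iffD1] linearI) (simp_all add: scale_right_distrib)
qed

lemma bounded_linear_scaleC_left: "bounded_linear (\<lambda>c. scaleC c x)"
proof -
  have "scaleC (r *\<^sub>R c) x = r *\<^sub>R scaleC c x" for r c
    by (metis scaleC_of_real scale_scale scaleR_conv_of_real)
  then show ?thesis
    by (intro linear_conv_bounded_linear[THEN iffD1] linearI) (simp_all add: scale_left_distrib)
qed

lemma inner_scaleC_ii: "scaleC \<i> x \<bullet> y = - (x \<bullet> scaleC \<i> y)"
proof -
  have "cinner (scaleC \<i> x) y = - cinner x (scaleC \<i> y)"
    using cinner_commute[of "scaleC \<i> x" y] cinner_commute[of x y] by (simp add: cinner_scaleC_right)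
  then show ?thesis
    by (metis Re_cinner uminus_complex.sel(1))
qed

lemma subgroup: "subgroup G GL_mat"
  using symmetric by (simp add: symmetric_subgroup_def)

lemma mat_1_in_G: "mat 1 \<in> G"
  using subgroup.one_closed[OF subgroup] by (simp add: GL_mat_def)

lemma mult_in_G: "g \<in> G \<Longrightarrow> h \<in> G \<Longrightarrow> g ** h \<in> G"
  using subgroup.m_closed[OF subgroup] by (simp add: GL_mat_def)

lemma rep_mult: "g \<in> G \<Longrightarrow> h \<in> G \<Longrightarrow> \<pi> (g ** h) x = \<pi> g (\<pi> h x)"
  using rational hom_mult[of \<pi> "GL_mat\<lparr>carrier := G\<rparr>" "GL_space scaleC" g h]
  by (simp add: rational_representation_def GL_mat_def GL_space_def)

lemma rep_GL:
  assumes "g \<in> G"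
  shows "Vector_Spaces.linear scaleC scaleC (\<pi> g)" "bij (\<pi> g)"
  using rational hom_in_carrier[of \<pi> "GL_mat\<lparr>carrier := G\<rparr>" "GL_space scaleC" g] assms
  by (simp_all add: rational_representation_def GL_space_def)

lemma rep_add: "g \<in> G \<Longrightarrow> \<pi> g (x + y) = \<pi> g x + \<pi> g y"
  using rep_GL(1) by (simp add: Vector_Spaces.linear_iff)

lemma rep_scaleC: "g \<in> G \<Longrightarrow> \<pi> g (scaleC c x) = scaleC c (\<pi> g x)"
  using rep_GL(1) by (simp add: Vector_Spaces.linear_iff)

lemma rep_nonzero:
  assumes "g \<in> G" "x \<noteq> 0"
  shows "\<pi> g x \<noteq> 0"
proof -
  have "\<pi> g 0 = 0"
    using rep_add[OF assms(1), of 0 0] by simp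
  then show ?thesis
    using bij_is_inj[OF rep_GL(2)[OF assms(1)]] assms(2) by (metis injD)
qed

lemma rep_mat_1: "\<pi> (mat 1) x = x"
proof -
  have "\<pi> (mat 1) (\<pi> (mat 1) x) = \<pi> (mat 1) x"
    using rep_mult[OF mat_1_in_G mat_1_in_G] by simp
  then show ?thesis
    using bij_is_inj[OF rep_GL(2)[OF mat_1_in_G]] by (metis injD)
qed

text \<open>The orbit map \<open>g \<mapsto> \<pi> g x\<close> is the restriction to \<open>G\<close> of a map on
  all matrices: replace each matrix entry of \<open>\<pi> g\<close> by the polynomial representing it. The derivative \<open>D\<close> of this extension
  gives \<open>\<Pi>(H) x = D H\<close>, so that linearity of \<open>\<Pi>(H) x\<close> in \<open>H\<close>, over the reals and over \<open>\<i>\<close>, and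
  its boundedness for \<open>\<parallel>H\<parallel> = 1\<close> all come from \<open>D\<close>.\<close>

lemma orbit_map_has_complex_derivative:
  obtains P D where "\<And>g. g \<in> G \<Longrightarrow> \<pi> g x = P g" and "(P has_derivative D) (at (mat 1))"
    and "\<And>c M. D (c *\<^sub>M M) = scaleC c (D M)"
proof -
  obtain B where B: "finite_dimensional_vector_space scaleC B"
    and ex: "\<forall>b\<in>B. \<forall>b'\<in>B. \<exists>p \<in> polynomials_in (insert (\<lambda>g. inverse (det g)) entry_functions).
           \<forall>g\<in>G. module.representation scaleC B (\<pi> g b) b' = p g"
    using rational unfolding rational_representation_def by blast
  interpret B: finite_dimensional_vector_space scaleC B by (rule B)
  have "\<exists>p D. (\<forall>g\<in>G. representation B (\<pi> g b) b' = p g) \<and> (p has_derivative D) (at (mat 1)) \<and>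
      (\<forall>c M. D (c *\<^sub>M M) = c * D M)" if b: "b \<in> B" and b': "b' \<in> B" for b b'
  proof -
    obtain p where p: "p \<in> polynomials_in (insert (\<lambda>g. inverse (det g)) entry_functions)"
      and eq: "\<forall>g\<in>G. representation B (\<pi> g b) b' = p g"
      using bspec[OF bspec[OF ex b] b'] by (elim bexE)
    have "invertible (mat 1 :: complex^'n^'n)"
      by (simp add: invertible_det_nz)
    then have D: "\<exists>D. (f has_derivative D) (at (mat 1)) \<and> (\<forall>c M. D (c *\<^sub>M M) = c * D M)"
      if "f \<in> insert (\<lambda>g. inverse (det g)) entry_functions" for f :: "complex^'n^'n \<Rightarrow> complex"
      using that inverse_det_has_complex_derivative entry_function_has_complex_derivative by blast
    show ?thesis
      using polynomials_in_has_complex_derivative[OF p D] eq by blast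
  qed
  then obtain p D where p: "\<And>b b' g. b \<in> B \<Longrightarrow> b' \<in> B \<Longrightarrow> g \<in> G \<Longrightarrow> representation B (\<pi> g b) b' = p b b' g"
    and D: "\<And>b b'. b \<in> B \<Longrightarrow> b' \<in> B \<Longrightarrow> (p b b' has_derivative D b b') (at (mat 1))"
    and Dc: "\<And>b b' c M. b \<in> B \<Longrightarrow> b' \<in> B \<Longrightarrow> D b b' (c *\<^sub>M M) = c * D b b' M"
    by metis
  have expand: "(\<Sum>b\<in>B. scaleC (representation B y b) b) = y" for y
    using sum_representation_eq[OF B.independent_Basis, of y B] B.span_Basis B.finite_Basis by simp
  let ?P = "\<lambda>g. \<Sum>b\<in>B. scaleC (representation B x b) (\<Sum>b'\<in>B. scaleC (p b b' g) b')"
  let ?D = "\<lambda>M. \<Sum>b\<in>B. scaleC (representation B x b) (\<Sum>b'\<in>B. scaleC (D b b' M) b')"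
  have "\<pi> g x = ?P g" if "g \<in> G" for g
  proof -
    interpret g: Vector_Spaces.linear scaleC scaleC "\<pi> g" by (rule rep_GL(1)[OF that])
    have "\<pi> g x = \<pi> g (\<Sum>b\<in>B. scaleC (representation B x b) b)"
      by (simp only: expand)
    also have "\<dots> = (\<Sum>b\<in>B. scaleC (representation B x b) (\<pi> g b))"
      by (simp add: g.sum g.scale)
    also have "\<dots> = ?P g"
    proof (rule sum.cong[OF refl])
      fix b assume "b \<in> B"
      have "\<pi> g b = (\<Sum>b'\<in>B. scaleC (representation B (\<pi> g b) b') b')"
        by (simp only: expand)
      also have "\<dots> = (\<Sum>b'\<in>B. scaleC (p b b' g) b')"
        using p[OF \<open>b \<in> B\<close> _ that] by simp
      finally show "scaleC (representation B x b) (\<pi> g b)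
          = scaleC (representation B x b) (\<Sum>b'\<in>B. scaleC (p b b' g) b')" by simp
    qed
    finally show ?thesis .
  qed
  moreover have "(?P has_derivative ?D) (at (mat 1))"
    by (intro has_derivative_sum bounded_linear.has_derivative[OF bounded_linear_scaleC]
        bounded_linear.has_derivative[OF bounded_linear_scaleC_left] D)
  moreover have "?D (c *\<^sub>M M) = scaleC c (?D M)" for c M
    by (simp add: Dc scale_sum_right mult.left_commute)
  ultimately show ?thesis by (rule that)
qed

text \<open>Along the curve \<open>exp (t H)\<close> the representation agrees with any extension \<open>P\<close> of the orbit map to
  all matrices, so the chain rule computes \<open>\<Pi>(H) x\<close> from the derivative of \<open>P\<close>.\<close>

lemma
  assumes "\<And>t::real. matrix_exp (t *\<^sub>R H) \<in> G"
  shows rep_exp_has_derivative: "((\<lambda>t. \<pi> (matrix_exp (t *\<^sub>R H)) x) has_vector_derivative Lie_rep \<pi> H x) (at 0)"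
    and Lie_rep_eq: "(\<And>g. g \<in> G \<Longrightarrow> \<pi> g x = P g) \<Longrightarrow> (P has_derivative D) (at (mat 1)) \<Longrightarrow> Lie_rep \<pi> H x = D H"
proof -
  have *: "((\<lambda>t. \<pi> (matrix_exp (t *\<^sub>R H)) x) has_vector_derivative D H) (at 0)"
    if P: "\<And>g. g \<in> G \<Longrightarrow> \<pi> g x = P g" and D: "(P has_derivative D) (at (mat 1))" for P D
  proof -
    have "(P has_derivative D) (at (matrix_exp ((0::real) *\<^sub>R H)))"
      unfolding matrix_exp_scaleR_0 by (rule D)
    from has_derivative_compose[OF matrix_exp_has_vector_derivative_0[unfolded has_vector_derivative_def] this]
    have "((\<lambda>t. P (matrix_exp (t *\<^sub>R H))) has_derivative (\<lambda>t. D (t *\<^sub>R H))) (at 0)" .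
    then show ?thesis
      using linear_simps(5)[OF has_derivative_bounded_linear[OF D]]
      by (simp add: has_vector_derivative_def P assms)
  qed
  show "Lie_rep \<pi> H x = D H" if "\<And>g. g \<in> G \<Longrightarrow> \<pi> g x = P g" "(P has_derivative D) (at (mat 1))"
    unfolding Lie_rep_def by (rule vector_derivative_at[OF *[OF that]])
  show "((\<lambda>t. \<pi> (matrix_exp (t *\<^sub>R H)) x) has_vector_derivative Lie_rep \<pi> H x) (at 0)"
  proof -
    obtain P D where P: "\<And>g. g \<in> G \<Longrightarrow> \<pi> g x = P g" and D: "(P has_derivative D) (at (mat 1))"
      and "\<And>c M. D (c *\<^sub>M M) = scaleC c (D M)"
      by (rule orbit_map_has_complex_derivative[of x]) blast
    show ?thesis
      using *[OF P D] unfolding Lie_rep_def by (simp add: vector_derivative_at)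
  qed
qed

text \<open>The complexification step: \<open>z\<close> is arbitrary complex although \<open>X\<close> is only known to generate
  a real one-parameter group in \<open>K\<close>.\<close>

lemma exp_Lie_in_G:
  assumes "X \<in> Lie (G \<inter> unitary_group)"
  shows "matrix_exp (z *\<^sub>M X) \<in> G"
  using assms symmetric
  by (intro zariski_closed_contains_complex_one_parameter) (auto simp: Lie_def symmetric_subgroup_def)

lemma exp_i_Lie_in_G:
  assumes "H \<in> i_Lie_K G"
  shows "matrix_exp (t *\<^sub>R H) \<in> G"
  using assms exp_Lie_in_G[of _ "of_real t * \<i>"]
  by (auto simp: i_Lie_K_def scaleR_eq_cscale cscale_cscale)

lemma Lie_rep_add:
  assumes "\<And>t::real. matrix_exp (t *\<^sub>R H) \<in> G"
  shows "Lie_rep \<pi> H (x + y) = Lie_rep \<pi> H x + Lie_rep \<pi> H y"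
proof -
  have "((\<lambda>t. \<pi> (matrix_exp (t *\<^sub>R H)) (x + y)) has_vector_derivative Lie_rep \<pi> H x + Lie_rep \<pi> H y) (at 0)"
    unfolding rep_add[OF assms] by (intro has_vector_derivative_add rep_exp_has_derivative assms)
  then show ?thesis
    using vector_derivative_unique_at rep_exp_has_derivative[OF assms] by blast
qed

lemma Lie_rep_scaleC:
  assumes "\<And>t::real. matrix_exp (t *\<^sub>R H) \<in> G"
  shows "Lie_rep \<pi> H (scaleC c x) = scaleC c (Lie_rep \<pi> H x)"
proof -
  have "((\<lambda>t. \<pi> (matrix_exp (t *\<^sub>R H)) (scaleC c x)) has_vector_derivative scaleC c (Lie_rep \<pi> H x)) (at 0)"
    unfolding rep_scaleC[OF assms]
    by (intro bounded_linear.has_vector_derivative[OF bounded_linear_scaleC] rep_exp_has_derivative assms)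
  then show ?thesis
    using vector_derivative_unique_at rep_exp_has_derivative[OF assms] by blast
qed

lemma bounded_linear_Lie_rep:
  assumes "\<And>t::real. matrix_exp (t *\<^sub>R H) \<in> G"
  shows "bounded_linear (Lie_rep \<pi> H)"
proof -
  have "Lie_rep \<pi> H (r *\<^sub>R x) = r *\<^sub>R Lie_rep \<pi> H x" for r x
    using Lie_rep_scaleC[OF assms, of "of_real r" x] by (simp add: scaleC_of_real)
  then show ?thesis
    by (intro linear_conv_bounded_linear[THEN iffD1] linearI) (simp_all add: Lie_rep_add assms)
qed

text \<open>This is where rationality of \<open>\<pi>\<close> enters: a merely smooth representation need not have a complex
  linear derivative.\<close>

lemma Lie_rep_ii:
  assumes "X \<in> Lie (G \<inter> unitary_group)"
  shows "Lie_rep \<pi> (\<i> *\<^sub>M X) x = scaleC \<i> (Lie_rep \<pi> X x)"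
proof -
  obtain P D where P: "\<And>g. g \<in> G \<Longrightarrow> \<pi> g x = P g" and D: "(P has_derivative D) (at (mat 1))"
    and complex: "\<And>c M. D (c *\<^sub>M M) = scaleC c (D M)"
    by (rule orbit_map_has_complex_derivative[of x]) blast
  have "Lie_rep \<pi> (z *\<^sub>M X) x = D (z *\<^sub>M X)" for z
    using assms by (intro Lie_rep_eq[OF _ P D]) (simp_all add: scaleR_eq_cscale cscale_cscale exp_Lie_in_G)
  from this[of 1] this[of \<i>] complex show ?thesis
    by (simp add: cscale_one)
qed

text \<open>Differentiate at \<open>t = 0\<close> the identity \<open>\<langle>\<pi>(exp (t X)) x, \<pi>(exp (t X)) y\<rangle> = \<langle>x, y\<rangle>\<close>.\<close>

lemma Lie_rep_skew:
  assumes "X \<in> Lie (G \<inter> unitary_group)"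
  shows "Lie_rep \<pi> X x \<bullet> y = - (x \<bullet> Lie_rep \<pi> X y)"
proof -
  let ?e = "\<lambda>t::real. matrix_exp (t *\<^sub>R X)"
  have e: "?e t \<in> G \<inter> unitary_group" for t
    using assms by (simp add: Lie_def)
  have "((\<lambda>t. \<pi> (?e t) x \<bullet> \<pi> (?e t) y) has_derivative
      (\<lambda>h. \<pi> (?e 0) x \<bullet> (h *\<^sub>R Lie_rep \<pi> X y) + (h *\<^sub>R Lie_rep \<pi> X x) \<bullet> \<pi> (?e 0) y)) (at 0)"
    using e rep_exp_has_derivative[of X] unfolding has_vector_derivative_def
    by (intro has_derivative_inner) auto
  moreover have "\<pi> (?e t) x \<bullet> \<pi> (?e t) y = x \<bullet> y" for t
    using unitary[OF e] by (metis Re_cinner)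
  ultimately have "((\<lambda>t::real. x \<bullet> y) has_derivative
      (\<lambda>h. h * (x \<bullet> Lie_rep \<pi> X y + Lie_rep \<pi> X x \<bullet> y))) (at 0)"
    by (simp only: matrix_exp_scaleR_0 rep_mat_1 inner_scaleR_left inner_scaleR_right distrib_left)
  from has_derivative_unique[OF this has_derivative_const]
  have "1 * (x \<bullet> Lie_rep \<pi> X y + Lie_rep \<pi> X x \<bullet> y) = 0"
    by (rule fun_cong)
  then show ?thesis by simp
qed

text \<open>\<open>\<Pi>(\<i> X) = \<i> \<Pi>(X)\<close> with \<open>\<Pi>(X)\<close> skew-Hermitian. In terms of the real inner product, multiplication
  by \<open>\<i>\<close> is a skew operator commuting with the skew operator \<open>\<Pi>(X)\<close>, so the composition is
  symmetric.\<close>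

lemma Lie_rep_selfadjoint:
  assumes "H \<in> i_Lie_K G"
  shows "Lie_rep \<pi> H x \<bullet> y = x \<bullet> Lie_rep \<pi> H y"
proof -
  obtain X where X: "X \<in> Lie (G \<inter> unitary_group)" and H: "H = \<i> *\<^sub>M X"
    using assms by (auto simp: i_Lie_K_def)
  have "matrix_exp (t *\<^sub>R X) \<in> G" for t :: real
    using X by (simp add: Lie_def)
  then have "Lie_rep \<pi> X (scaleC \<i> y) = scaleC \<i> (Lie_rep \<pi> X y)"
    by (rule Lie_rep_scaleC)
  then show ?thesis
    unfolding H Lie_rep_ii[OF X] by (simp add: inner_scaleC_ii Lie_rep_skew[OF X])
qed

lemma Lie_rep_scaleR:
  assumes "\<And>t::real. matrix_exp (t *\<^sub>R H) \<in> G"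
  shows "Lie_rep \<pi> (r *\<^sub>R H) x = r *\<^sub>R Lie_rep \<pi> H x"
proof -
  obtain P D where P: "\<And>g. g \<in> G \<Longrightarrow> \<pi> g x = P g" and D: "(P has_derivative D) (at (mat 1))"
    and "\<And>c M. D (c *\<^sub>M M) = scaleC c (D M)"
    by (rule orbit_map_has_complex_derivative[of x]) blast
  have "Lie_rep \<pi> (r *\<^sub>R H) x = D (r *\<^sub>R H)" for r
    using assms by (intro Lie_rep_eq[OF _ P D]) simp_all
  from this[of 1] this[of r] show ?thesis
    using linear_simps(5)[OF has_derivative_bounded_linear[OF D]] by simp
qed

lemma scaleR_i_Lie_K:
  assumes "H \<in> i_Lie_K G"
  shows "r *\<^sub>R H \<in> i_Lie_K G"
proof -
  obtain X where X: "X \<in> Lie (G \<inter> unitary_group)" and H: "H = \<i> *\<^sub>M X"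
    using assms by (auto simp: i_Lie_K_def)
  have "r *\<^sub>R X \<in> Lie (G \<inter> unitary_group)"
    using X by (simp add: Lie_def)
  moreover have "r *\<^sub>R H = \<i> *\<^sub>M (r *\<^sub>R X)"
    by (simp add: H scaleR_eq_cscale cscale_cscale mult.commute)
  ultimately show ?thesis by (simp add: i_Lie_K_def)
qed

text \<open>Without this bound the supremum in \<^const>\<open>weight_norm\<close> would be an unspecified number. The operator
  norm is at most the sum of the norms of the images of a basis, and each of these images depends on
  \<open>H\<close> through a bounded linear map.\<close>

lemma bdd_above_onorm_Lie_rep: "bdd_above {onorm (Lie_rep \<pi> H) | H. H \<in> i_Lie_K G \<and> norm H = 1}"
proof -
  have "\<exists>C. \<forall>H\<in>i_Lie_K G. norm (Lie_rep \<pi> H x) \<le> C * norm H" for x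
  proof -
    obtain P D where P: "\<And>g. g \<in> G \<Longrightarrow> \<pi> g x = P g" and D: "(P has_derivative D) (at (mat 1))"
      and "\<And>c M. D (c *\<^sub>M M) = scaleC c (D M)"
      by (rule orbit_map_has_complex_derivative[of x]) blast
    have "Lie_rep \<pi> H x = D H" if "H \<in> i_Lie_K G" for H
      by (rule Lie_rep_eq[OF exp_i_Lie_in_G[OF that] P D])
    then show ?thesis
      using onorm[OF has_derivative_bounded_linear[OF D]] by (intro exI[of _ "onorm D"]) simp
  qed
  then have "\<exists>C. \<forall>x. \<forall>H\<in>i_Lie_K G. norm (Lie_rep \<pi> H x) \<le> C x * norm H"
    by (intro choice allI)
  then obtain C where C: "\<forall>x. \<forall>H\<in>i_Lie_K G. norm (Lie_rep \<pi> H x) \<le> C x * norm H"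
    by (elim exE)
  have "onorm (Lie_rep \<pi> H) \<le> (\<Sum>b\<in>Basis. C b)" if "H \<in> i_Lie_K G" "norm H = 1" for H
  proof -
    have "onorm (Lie_rep \<pi> H) \<le> (\<Sum>b\<in>Basis. norm (Lie_rep \<pi> H b))"
      by (intro onorm_componentwise bounded_linear_Lie_rep exp_i_Lie_in_G that(1))
    also have "\<dots> \<le> (\<Sum>b\<in>Basis. C b)"
      using C[rule_format, OF that(1)] that(2) by (intro sum_mono) simp
    finally show ?thesis .
  qed
  then show ?thesis
    by (intro bdd_aboveI[of _ "\<Sum>b\<in>Basis. C b"]) auto
qed

lemma norm_Lie_rep_le:
  assumes H: "H \<in> i_Lie_K G"
  shows "norm (Lie_rep \<pi> H x) \<le> weight_norm G \<pi> * norm H * norm x"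
proof (cases "H = 0")
  case True
  then show ?thesis
    using Lie_rep_scaleR[OF exp_i_Lie_in_G[OF H], of 0 x] by simp
next
  case False
  define U where "U = (1 / norm H) *\<^sub>R H"
  have U: "U \<in> i_Lie_K G" "norm U = 1" and HU: "H = norm H *\<^sub>R U"
    using False by (simp_all add: U_def scaleR_i_Lie_K H)
  have "norm (Lie_rep \<pi> U x) \<le> onorm (Lie_rep \<pi> U) * norm x"
    by (intro onorm bounded_linear_Lie_rep exp_i_Lie_in_G U)
  also have "\<dots> \<le> weight_norm G \<pi> * norm x"
    unfolding weight_norm_def using U by (intro mult_right_mono cSup_upper bdd_above_onorm_Lie_rep) auto
  finally have le: "norm (Lie_rep \<pi> U x) \<le> weight_norm G \<pi> * norm x" .
  have "norm (Lie_rep \<pi> H x) = norm (Lie_rep \<pi> (norm H *\<^sub>R U) x)"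
    using HU by (rule arg_cong)
  also have "\<dots> = norm H * norm (Lie_rep \<pi> U x)"
    unfolding Lie_rep_scaleR[OF exp_i_Lie_in_G[OF U(1)]] by simp
  also have "\<dots> \<le> norm H * (weight_norm G \<pi> * norm x)"
    by (intro mult_left_mono le) simp
  finally show ?thesis by (simp only: mult_ac)
qed

text \<open>The group law \<open>exp (s H) = exp ((s - t) H) exp (t H)\<close> reduces the derivative at \<open>t\<close> to the one at
  \<open>0\<close>, taken at the moved vector. The orbit thus solves a linear differential equation with constant
  coefficients.\<close>

lemma orbit_flow:
  assumes "\<And>t::real. matrix_exp (t *\<^sub>R H) \<in> G" "g \<in> G"
  shows "((\<lambda>s. \<pi> (matrix_exp (s *\<^sub>R H) ** g) v) has_vector_derivative
      Lie_rep \<pi> H (\<pi> (matrix_exp (t *\<^sub>R H) ** g) v)) (at t)"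
proof -
  let ?w = "\<pi> (matrix_exp (t *\<^sub>R H) ** g) v"
  have "\<pi> (matrix_exp (s *\<^sub>R H) ** g) v = \<pi> (matrix_exp ((s - t) *\<^sub>R H)) ?w" for s
  proof -
    have "matrix_exp (s *\<^sub>R H) = matrix_exp ((s - t) *\<^sub>R H) ** matrix_exp (t *\<^sub>R H)"
      using matrix_exp_add[of "of_real (s - t)" "of_real t" H] by (simp add: scaleR_eq_cscale)
    then have "\<pi> (matrix_exp (s *\<^sub>R H) ** g) v = \<pi> (matrix_exp ((s - t) *\<^sub>R H) ** (matrix_exp (t *\<^sub>R H) ** g)) v"
      by (simp only: matrix_mul_assoc)
    also have "\<dots> = \<pi> (matrix_exp ((s - t) *\<^sub>R H)) ?w"
      by (rule rep_mult[OF assms(1) mult_in_G[OF assms]])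
    finally show ?thesis .
  qed
  then have "(\<lambda>s. \<pi> (matrix_exp (s *\<^sub>R H) ** g) v) = (\<lambda>s. \<pi> (matrix_exp ((s - t) *\<^sub>R H)) ?w)"
    by (rule ext)
  moreover have "((\<lambda>s. \<pi> (matrix_exp ((s - t) *\<^sub>R H)) ?w) has_vector_derivative Lie_rep \<pi> H ?w) (at t)"
    using vector_diff_chain_at[of "\<lambda>s. s - t" 1 t "\<lambda>s. \<pi> (matrix_exp (s *\<^sub>R H)) ?w" "Lie_rep \<pi> H ?w"]
      rep_exp_has_derivative[OF assms(1), of ?w]
    by (simp add: o_def has_vector_derivative_diff_const del: scaleR_left_diff_distrib)
  ultimately show ?thesis
    by (rule ssubst[where P = "\<lambda>f. (f has_vector_derivative _) _"])
qed

end

section \<open>The logarithmic norm along a self-adjoint linear flow\<close>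

text \<open>In finite dimension, an eigenbasis of \<open>S\<close> shows that the solution of \<open>u' = S u\<close> has \<open>\<parallel>u t\<parallel>\<^sup>2 = (\<Sum>i. a i * exp (2 * t * e i))\<close> with \<open>a i \<ge> 0\<close>, so up to a constant
  \<open>ln (\<parallel>u t\<parallel>\<^sup>2)\<close> is a cumulant generating function at \<open>2 t\<close>, and \<open>f\<close> is half of it. Its derivatives are
  \<open>f' = m\<close>, \<open>f'' = 2 V\<close> and \<open>f''' = 4 K\<close>, where \<open>m\<close>, \<open>V\<close> and \<open>K\<close> are the mean, the variance and the
  third central moment of the spectral distribution of \<open>S\<close> in the state \<open>u t\<close>. All eigenvalues and the
  mean lie in \<open>[-c, c]\<close>, so that \<open>\<bar>K\<bar> \<le> 2 c V\<close>. The proof needs no eigenbasis: the moments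
  are \<open>q k t / q 0 t\<close> with \<open>q k t = u t \<bullet> (S ^^ k) (u t)\<close>, and the derivative of \<open>q k\<close> is \<open>2 q (k + 1)\<close>.\<close>

lemma log_norm_flow_robust:
  fixes u :: "real \<Rightarrow> 'v::real_inner"
  assumes S: "bounded_linear S"
    and selfadjoint: "\<And>x y. S x \<bullet> y = x \<bullet> S y"
    and bound: "\<And>x. norm (S x) \<le> c * norm x"
    and flow: "\<And>t. (u has_vector_derivative S (u t)) (at t)"
    and nonzero: "\<And>t. u t \<noteq> 0"
  defines "f \<equiv> \<lambda>t. ln (norm (u t))"
  shows "(\<forall>k<3. (deriv ^^ k) f differentiable at t) \<and> \<bar>(deriv ^^ 3) f t\<bar> \<le> 4 * c * (deriv ^^ 2) f t"
proof -
  define q where "q k t = u t \<bullet> (S ^^ k) (u t)" for k t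
  have q_deriv [derivative_intros]: "(q k has_real_derivative 2 * q (Suc k) t) (at t)" for k t
  proof -
    have "bounded_linear (S ^^ k)"
      by (induction k) (simp_all add: id_def o_def bounded_linear_ident bounded_linear_compose[OF S])
    then have "((\<lambda>t. (S ^^ k) (u t)) has_derivative (\<lambda>h. (S ^^ k) (h *\<^sub>R S (u t)))) (at t)"
      using flow[of t] unfolding has_vector_derivative_def by (rule bounded_linear.has_derivative)
    moreover have "(S ^^ k) (h *\<^sub>R S (u t)) = h *\<^sub>R (S ^^ Suc k) (u t)" for h
      using \<open>bounded_linear (S ^^ k)\<close> by (simp add: linear_simps funpow_swap1)
    ultimately have "((\<lambda>t. u t \<bullet> (S ^^ k) (u t)) has_derivative
        (\<lambda>h. u t \<bullet> (h *\<^sub>R (S ^^ Suc k) (u t)) + (h *\<^sub>R S (u t)) \<bullet> (S ^^ k) (u t))) (at t)"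
      using flow[of t] unfolding has_vector_derivative_def by (intro has_derivative_inner) simp_all
    then show ?thesis
      unfolding q_def[abs_def] has_field_derivative_def
      by (rule has_derivative_eq_rhs) (simp add: fun_eq_iff selfadjoint)
  qed
  have q0: "q 0 t > 0" for t
    using nonzero[of t] by (simp add: q_def)
  have "deriv f t = q 1 t / q 0 t" and f: "f differentiable at t" for t
  proof -
    have "f = (\<lambda>t. ln (q 0 t) / 2)"
      by (simp add: f_def q_def norm_eq_sqrt_inner ln_sqrt)
    then have "(f has_real_derivative q 1 t / q 0 t) (at t)"
      using q0[of t] by (auto intro!: derivative_eq_intros simp: field_simps)
    then show "deriv f t = q 1 t / q 0 t" "f differentiable at t"
      by (auto intro: DERIV_imp_deriv simp: real_differentiable_def)
  qed
  then have f1: "deriv f = (\<lambda>t. q 1 t / q 0 t)" by blast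
  have f1': "(deriv f has_real_derivative 2 * (q 2 t / q 0 t - (q 1 t / q 0 t)^2)) (at t)" for t
    unfolding f1 using q0[of t]
    by (auto intro!: derivative_eq_intros simp: field_simps power2_eq_square eval_nat_numeral)
  then have f2: "deriv (deriv f) = (\<lambda>t. 2 * (q 2 t / q 0 t - (q 1 t / q 0 t)^2))"
    by (blast intro: DERIV_imp_deriv)
  have f2': "(deriv (deriv f) has_real_derivative
      4 * (q 3 t / q 0 t - 3 * (q 1 t / q 0 t) * (q 2 t / q 0 t) + 2 * (q 1 t / q 0 t)^3)) (at t)" for t
    unfolding f2 using q0[of t]
    by (auto intro!: derivative_eq_intros simp: field_simps eval_nat_numeral)
  \<comment> \<open>The centred vector \<open>y\<close> gives \<open>V = \<parallel>y\<parallel>\<^sup>2 / q 0 t\<close> and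
    \<open>K = (y \<bullet> S y - m \<parallel>y\<parallel>\<^sup>2) / q 0 t\<close>; both numerators are bounded via \<open>\<parallel>y\<parallel>\<^sup>2\<close>.\<close>
  define m where "m = q 1 t / q 0 t"
  define y where "y = S (u t) - m *\<^sub>R u t"
  have m: "q 1 t = m * q 0 t"
    using q0[of t] by (simp add: m_def)
  interpret S: bounded_linear S by (rule S)
  have yy: "y \<bullet> y / q 0 t = q 2 t / q 0 t - m^2"
  proof -
    have "y \<bullet> y = q 2 t - 2 * m * q 1 t + m^2 * q 0 t"
      by (simp add: y_def q_def inner_diff selfadjoint inner_commute eval_nat_numeral algebra_simps)
    then show ?thesis using q0[of t] unfolding m by (simp add: field_simps power2_eq_square)
  qed
  have ySy: "(y \<bullet> S y - m * (y \<bullet> y)) / q 0 t = q 3 t / q 0 t - 3 * m * (q 2 t / q 0 t) + 2 * m^3"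
  proof -
    have "y \<bullet> S y - m * (y \<bullet> y) = q 3 t - 3 * m * q 2 t + 3 * m^2 * q 1 t - m^3 * q 0 t"
      by (simp add: y_def q_def inner_diff S.diff S.scaleR selfadjoint inner_commute eval_nat_numeral algebra_simps)
    then show ?thesis using q0[of t] unfolding m by (simp add: field_simps power2_eq_square power3_eq_cube)
  qed
  have num: "\<bar>x \<bullet> S x\<bar> \<le> c * (x \<bullet> x)" for x
  proof -
    have "\<bar>x \<bullet> S x\<bar> \<le> norm x * norm (S x)" by (rule Cauchy_Schwarz_ineq2)
    also have "\<dots> \<le> norm x * (c * norm x)" by (intro mult_left_mono bound) simp
    also have "\<dots> = c * (x \<bullet> x)" by (simp add: power2_norm_eq_inner[symmetric] power2_eq_square)
    finally show ?thesis .
  qed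
  have "\<bar>m\<bar> \<le> c"
    using num[of "u t"] q0[of t] by (simp add: m_def q_def field_simps abs_divide)
  have "\<bar>y \<bullet> S y - m * (y \<bullet> y)\<bar> \<le> \<bar>y \<bullet> S y\<bar> + \<bar>m\<bar> * (y \<bullet> y)"
    by (rule order_trans[OF abs_triangle_ineq4]) (simp add: abs_mult)
  also have "\<dots> \<le> c * (y \<bullet> y) + c * (y \<bullet> y)"
    using num[of y] \<open>\<bar>m\<bar> \<le> c\<close> by (intro add_mono mult_right_mono) auto
  finally have le: "\<bar>(y \<bullet> S y - m * (y \<bullet> y)) / q 0 t\<bar> \<le> 2 * c * (y \<bullet> y / q 0 t)"
    using q0[of t] by (simp add: abs_divide divide_right_mono)
  have f2_y: "(deriv ^^ 2) f t = 2 * (y \<bullet> y / q 0 t)"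
  proof -
    have "(deriv ^^ 2) f = deriv (deriv f)" by (simp add: eval_nat_numeral)
    then show ?thesis by (simp only: f2 yy m_def)
  qed
  have f3_y: "(deriv ^^ 3) f t = 4 * ((y \<bullet> S y - m * (y \<bullet> y)) / q 0 t)"
  proof -
    have "(deriv ^^ 3) f = deriv (deriv (deriv f))" by (simp add: eval_nat_numeral)
    then show ?thesis using DERIV_imp_deriv[OF f2'[of t]] by (simp only: ySy m_def[symmetric])
  qed
  have "\<bar>(deriv ^^ 3) f t\<bar> = 4 * \<bar>(y \<bullet> S y - m * (y \<bullet> y)) / q 0 t\<bar>"
    by (simp only: f3_y abs_mult abs_numeral)
  also have "\<dots> \<le> 4 * (2 * c * (y \<bullet> y / q 0 t))"
    using le by (rule mult_left_mono) simp
  also have "\<dots> = 4 * c * (deriv ^^ 2) f t"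
    by (simp add: f2_y)
  finally have "\<bar>(deriv ^^ 3) f t\<bar> \<le> 4 * c * (deriv ^^ 2) f t" .
  moreover have "(deriv ^^ k) f differentiable at t" if "k < 3" for k
  proof -
    have "k = 0 \<or> k = 1 \<or> k = 2" using that by linarith
    then show ?thesis
      using f[of t] real_differentiable_def[THEN iffD2, OF exI, OF f1'[of t]] real_differentiable_def[THEN iffD2, OF exI, OF f2'[of t]]
      by (auto simp: eval_nat_numeral)
  qed
  ultimately show ?thesis by blast
qed

section \<open>Robustness\<close>

theorem proposition3p15:
  fixes G :: "(complex^'n^'n) set"
    and scaleC :: "complex \<Rightarrow> 'v::euclidean_space \<Rightarrow> 'v"
    and cinner :: "'v \<Rightarrow> 'v \<Rightarrow> complex"
    and \<pi> :: "complex^'n^'n \<Rightarrow> 'v \<Rightarrow> 'v"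
    and v :: 'v
  assumes "symmetric_subgroup G"
    and "hermitian_space scaleC cinner"
    and "rational_representation scaleC G \<pi>"
    and "\<And>k x y. k \<in> G \<inter> unitary_group \<Longrightarrow> cinner (\<pi> k x) (\<pi> k y) = cinner x y"
    and "v \<noteq> 0"
  shows "robust G (4 * weight_norm G \<pi>) (\<lambda>g. ln (norm (\<pi> g v)))"
proof -
  interpret unitary_rational_representation scaleC cinner G \<pi>
    using assms(1-4)
    by (intro unitary_rational_representation.intro unitary_rational_representation_axioms.intro)
  show ?thesis
    unfolding robust_def Let_def
  proof (intro ballI allI)
    fix g H and t :: real
    assume g: "g \<in> G" and H: "H \<in> i_Lie_K G"
    have exp: "matrix_exp (s *\<^sub>R H) \<in> G" for s :: real
      by (rule exp_i_Lie_in_G[OF H])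
    show "(\<forall>k<3. (deriv ^^ k) (\<lambda>s. ln (norm (\<pi> (matrix_exp (s *\<^sub>R H) ** g) v))) differentiable at t) \<and>
        \<bar>(deriv ^^ 3) (\<lambda>s. ln (norm (\<pi> (matrix_exp (s *\<^sub>R H) ** g) v))) t\<bar>
        \<le> 4 * weight_norm G \<pi> * norm H * (deriv ^^ 2) (\<lambda>s. ln (norm (\<pi> (matrix_exp (s *\<^sub>R H) ** g) v))) t"
      unfolding mult.assoc[of 4 "weight_norm G \<pi>" "norm H"]
      by (rule log_norm_flow_robust[OF bounded_linear_Lie_rep[OF exp] Lie_rep_selfadjoint[OF H]
          norm_Lie_rep_le[OF H] orbit_flow[OF exp g] rep_nonzero[OF mult_in_G[OF exp g] assms(5)]])
  qed
qed

end
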